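(* Let $n\geq 1$ and let $\vec{a}=(a_1,\ldots,a_n),\ \vec{b}=(b_1,\ldots,b_n)\in\mathbb{R}^n$ be such that $1<\langle\vec{a},\vec{b}\rangle$. Then for all $s\in\mathbb{N}$, $$\left|\int_{|a_n|}^{|b_n|}\int_{|a_{n-1}|}^{|b_{n-1}|}\cdots\int_{|a_1|}^{|b_1|}\sqrt[4s]{\sum_{j=1}^{n}x_j^{4s}}\;dx_1\,dx_2\cdots dx_n\right|\ \leq\ \frac{|\langle\vec{a},\vec{b}\rangle|}{2\pi\,|\log(\langle\vec{a},\vec{b}\rangle)|}\,\bigl(\|\vec{a}\|^{4s+1}+\|\vec{b}\|^{4s+1}\bigr)\,\left|\prod_{j=1}^{n}\bigl(|b_j|-|a_j|\bigr)\right|.$$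
   Context: $\langle\cdot,\cdot\rangle$ is the inner product on $\mathbb{R}^n$, $\langle\vec{a},\vec{b}\rangle=\sum_j a_jb_j$, and $\|\cdot\|$ is the associated (Euclidean) norm. $\mathbb{N}$ is the set of positive integers. Integrals are iterated oriented integrals ($\int_p^q=-\int_q^p$); the limits $|a_j|,|b_j|$ are not assumed ordered. *)

theory Defs
  imports "HOL-Analysis.Analysis"
begin

text \<open>
  The iterated integral below is defined by recursion on the dimension \<open>n\<close>, so \<open>n\<close> cannot be
  encoded in a type.  A vector of \<open>\<real>\<^sup>n\<close> is a function of type \<^typ>\<open>nat \<Rightarrow> real\<close>
  of which only the values at the indices \<open>1, \<dots>, n\<close> are used.
\<close>

definition inner_prod :: "nat \<Rightarrow> (nat \<Rightarrow> real) \<Rightarrow> (nat \<Rightarrow> real) \<Rightarrow> real" where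
  "inner_prod n a b = (\<Sum>j=1..n. a j * b j)"

definition euclid_norm :: "nat \<Rightarrow> (nat \<Rightarrow> real) \<Rightarrow> real" where
  "euclid_norm n a = sqrt (inner_prod n a a)"

text \<open>
  \<open>iterated_integral p q n f x\<close> integrates \<open>f\<close> over the coordinates \<open>1, \<dots>, n\<close>, coordinate \<open>k\<close>
  running from \<open>p k\<close> to \<open>q k\<close>; the integral over coordinate \<open>n\<close> is outermost, that over
  coordinate \<open>1\<close> innermost.  The point \<open>x\<close> supplies the coordinates that are not integrated over;
  its values at \<open>1, \<dots>, n\<close> are overwritten.  The one-dimensional interval integral is oriented:
  swapping its endpoints changes the sign.
\<close>

primrec iterated_integral ::
  "(nat \<Rightarrow> real) \<Rightarrow> (nat \<Rightarrow> real) \<Rightarrow> nat \<Rightarrow> ((nat \<Rightarrow> real) \<Rightarrow> real) \<Rightarrow> (nat \<Rightarrow> real) \<Rightarrow> real"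
where
  "iterated_integral p q 0 f x = f x"
| "iterated_integral p q (Suc k) f x =
     (LBINT t=ereal (p (Suc k))..ereal (q (Suc k)).
        iterated_integral p q k f (x(Suc k := t)))"

end

theory Submission
  imports Defs
begin

text \<open>
  On the box the integrand is at most the Euclidean norm of the point, hence at most
  \<open>\<parallel>a\<parallel> + \<parallel>b\<parallel>\<close>, so the integral is at most \<open>\<parallel>a\<parallel> + \<parallel>b\<parallel>\<close> times the volume.  With
  \<open>X = \<langle>a, b\<rangle> \<le> \<parallel>a\<parallel> \<parallel>b\<parallel>\<close>, Chebyshev's sum inequality and AM-GM give
  \<open>\<parallel>a\<parallel> ^ (4 * s + 1) + \<parallel>b\<parallel> ^ (4 * s + 1) \<ge> (\<parallel>a\<parallel> + \<parallel>b\<parallel>) * X ^ (2 * s)\<close>, and the claim reduces to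
  \<open>2 * pi * ln X \<le> X ^ 3\<close>, which holds because \<open>X ^ 3 / ln X \<ge> 3 * e\<close>.
\<close>

text \<open>If \<open>g\<close> is not integrable, its integral is 0 by convention and the bound
  persists because \<open>C\<close> is nonnegative. Iterated integrals can thus be bounded without a
  measurability argument for the inner ones.\<close>

lemma abs_interval_integral_le:
  fixes g :: "real \<Rightarrow> real"
  assumes bound: "\<And>t. min p q \<le> t \<Longrightarrow> t \<le> max p q \<Longrightarrow> \<bar>g t\<bar> \<le> C"
  shows "\<bar>LBINT t=ereal p..ereal q. g t\<bar> \<le> C * \<bar>q - p\<bar>"
proof -
  have C: "0 \<le> C"
    using bound[of p] by auto
  have *: "\<bar>LBINT t:{u<..<v}. g t\<bar> \<le> C * (v - u)"
    if "u \<le> v" and g: "\<And>t. u \<le> t \<Longrightarrow> t \<le> v \<Longrightarrow> \<bar>g t\<bar> \<le> C" for u v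
  proof (cases "set_integrable lborel {u<..<v} g")
    case True
    have "\<bar>LBINT t:{u<..<v}. g t\<bar> \<le> (LBINT t:{u<..<v}. \<bar>g t\<bar>)"
      using set_integral_norm_bound[OF True] by simp
    also have "\<dots> \<le> (LBINT t:{u<..<v}. C)"
    proof (rule set_integral_mono)
      show "set_integrable lborel {u<..<v} (\<lambda>t. \<bar>g t\<bar>)"
        using True by (rule set_integrable_abs)
      show "set_integrable lborel {u<..<v} (\<lambda>t. C)"
        using that(1) by (simp add: set_integrable_def)
    qed (use g in auto)
    also have "\<dots> = C * (v - u)"
      using that(1) by (simp add: set_integral_const)
    finally show ?thesis .
  next
    case False
    then have "(LBINT t:{u<..<v}. g t) = 0"
      by (simp add: set_lebesgue_integral_def set_integrable_def not_integrable_integral_eq)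
    then show ?thesis
      using C that(1) by simp
  qed
  \<comment> \<open>For \<open>q < p\<close> the oriented integral is minus the integral over the
    reversed interval; the absolute value removes the sign.\<close>
  show ?thesis
    using *[of p q] *[of q p] bound
    by (cases "p \<le> q") (auto simp: interval_lebesgue_integral_def min_def max_def)
qed

text \<open>Induction on the dimension, peeling off the outermost coordinate. The clause that
  \<open>y\<close> agrees with \<open>x\<close> off \<open>{1..n}\<close> remembers the values
  already fixed, so the range of coordinate \<open>Suc n\<close> is still known when
  \<open>f\<close> is finally bounded.\<close>

lemma abs_iterated_integral_le:
  assumes "\<And>y. (\<forall>j\<in>{1..n}. min (p j) (q j) \<le> y j \<and> y j \<le> max (p j) (q j)) \<Longrightarrow>
      (\<forall>j. j \<notin> {1..n} \<longrightarrow> y j = x j) \<Longrightarrow> \<bar>f y\<bar> \<le> C"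
  shows "\<bar>iterated_integral p q n f x\<bar> \<le> C * \<bar>\<Prod>j=1..n. (q j - p j)\<bar>"
  using assms
proof (induction n arbitrary: x)
  case 0
  then show ?case by auto
next
  case (Suc n)
  have "\<bar>iterated_integral p q n f (x(Suc n := t))\<bar> \<le> C * \<bar>\<Prod>j=1..n. (q j - p j)\<bar>"
    if t: "min (p (Suc n)) (q (Suc n)) \<le> t" "t \<le> max (p (Suc n)) (q (Suc n))" for t
  proof (rule Suc.IH)
    fix y
    assume y: "\<forall>j\<in>{1..n}. min (p j) (q j) \<le> y j \<and> y j \<le> max (p j) (q j)"
      and y': "\<forall>j. j \<notin> {1..n} \<longrightarrow> y j = (x(Suc n := t)) j"
    have "y (Suc n) = t"
      using y' by simp
    then show "\<bar>f y\<bar> \<le> C"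
      using y y' t by (intro Suc.prems) (auto simp: atLeastAtMostSuc_conv)
  qed
  from abs_interval_integral_le[OF this] show ?case
    by (simp add: abs_mult mult.assoc)
qed

text \<open>Each \<open>y j\<close> is at most the total, so all but one of the factors of
  \<open>y j ^ m\<close> may be replaced by it.\<close>

lemma sum_power_le_power_sum:
  fixes y :: "'a \<Rightarrow> real"
  assumes "finite A" and "\<And>j. j \<in> A \<Longrightarrow> 0 \<le> y j" and "m \<ge> 1"
  shows "(\<Sum>j\<in>A. y j ^ m) \<le> (\<Sum>j\<in>A. y j) ^ m"
proof -
  obtain k where m: "m = Suc k"
    using assms(3) by (cases m) auto
  have "(\<Sum>j\<in>A. y j ^ m) \<le> (\<Sum>j\<in>A. y j * (\<Sum>j\<in>A. y j) ^ k)"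
    unfolding m power_Suc using assms(1,2)
    by (intro sum_mono mult_left_mono power_mono member_le_sum) auto
  then show ?thesis
    by (simp add: m sum_distrib_right)
qed

text \<open>The l^p norms decrease in p: the previous lemma is applied to the squares with exponent
  \<open>2 * s\<close>.\<close>

lemma root_sum_power_le_sqrt_sum_squares:
  fixes y :: "'a \<Rightarrow> real"
  assumes "finite A" and "s \<ge> 1"
  shows "root (4 * s) (\<Sum>j\<in>A. y j ^ (4 * s)) \<le> sqrt (\<Sum>j\<in>A. (y j)\<^sup>2)"
proof -
  have "(\<Sum>j\<in>A. y j ^ (4 * s)) = (\<Sum>j\<in>A. ((y j)\<^sup>2) ^ (2 * s))"
    by (simp flip: power_mult)
  also have "\<dots> \<le> (\<Sum>j\<in>A. (y j)\<^sup>2) ^ (2 * s)"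
    using assms by (intro sum_power_le_power_sum) auto
  also have "\<dots> = sqrt (\<Sum>j\<in>A. (y j)\<^sup>2) ^ (4 * s)"
  proof -
    have "sqrt (\<Sum>j\<in>A. (y j)\<^sup>2) ^ (4 * s) = ((sqrt (\<Sum>j\<in>A. (y j)\<^sup>2))\<^sup>2) ^ (2 * s)"
      by (simp only: flip: power_mult) simp
    then show ?thesis
      by (simp add: sum_nonneg)
  qed
  finally have "root (4 * s) (\<Sum>j\<in>A. y j ^ (4 * s))
      \<le> root (4 * s) (sqrt (\<Sum>j\<in>A. (y j)\<^sup>2) ^ (4 * s))"
    using assms by (intro real_root_le_mono) auto
  then show ?thesis
    using assms by (simp add: real_root_power_cancel sum_nonneg)
qed

lemma two_pi_ln_le_power:
  assumes "1 < X" and "m \<ge> 3"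
  shows "2 * pi * ln X \<le> X ^ m"
proof -
  \<comment> \<open>Three terms of the exponential series suffice: 3 * 5/2 = 7.5 already exceeds 2
    pi = 6.28...\<close>
  have e: "(5/2 :: real) \<le> exp 1"
    using exp_lower_Taylor_quadratic[of "1::real"] by simp
  have "3 * ln X = ln (X ^ 3)"
    using assms by (simp add: ln_realpow)
  also have "\<dots> = 1 + ln (X ^ 3 / exp 1)"
    using assms by (simp add: ln_div)
  \<comment> \<open>This is \<open>1 + ln u \<le> u\<close> at \<open>u = X ^ 3 / exp 1\<close>,
    with equality at \<open>X ^ 3 = exp 1\<close>.\<close>
  also have "\<dots> \<le> X ^ 3 / exp 1"
    using assms ln_le_minus_one[of "X ^ 3 / exp 1"] by simp
  also have "\<dots> \<le> X ^ 3 / (5/2)"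
    using assms e by (intro divide_left_mono) auto
  finally have "15 / 2 * ln X \<le> X ^ 3"
    by simp
  moreover have "2 * pi * ln X \<le> 15 / 2 * ln X"
    using assms pi_approx by (intro mult_right_mono) auto
  moreover have "X ^ 3 \<le> X ^ m"
    using assms by (intro power_increasing) auto
  ultimately show ?thesis
    by linarith
qed

lemma add_mult_power_le_power_add:
  fixes A B X :: real
  assumes "0 \<le> A" "0 \<le> B" "0 \<le> X" "X \<le> A * B"
  shows "(A + B) * X ^ (2 * s) \<le> A ^ (4 * s + 1) + B ^ (4 * s + 1)"
proof -
  have "X ^ (2 * s) \<le> (A * B) ^ (2 * s)"
    using assms by (intro power_mono) auto
  also have "\<dots> = A ^ (2 * s) * B ^ (2 * s)"
    by (rule power_mult_distrib)
  also have "\<dots> \<le> ((A ^ (2 * s))\<^sup>2 + (B ^ (2 * s))\<^sup>2) / 2"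
    using sum_squares_bound[of "A ^ (2 * s)" "B ^ (2 * s)"] by simp
  also have "\<dots> = (A ^ (4 * s) + B ^ (4 * s)) / 2"
    by (simp flip: power_mult)
  finally have "(A + B) * X ^ (2 * s) \<le> (A + B) * ((A ^ (4 * s) + B ^ (4 * s)) / 2)"
    using assms by (intro mult_left_mono) auto
  \<comment> \<open>Chebyshev's inequality for two terms: half of this product is
    \<open>A ^ (4 * s + 1) + B ^ (4 * s + 1)\<close> minus the right-hand side just
    obtained.\<close>
  moreover have "0 \<le> (A - B) * (A ^ (4 * s) - B ^ (4 * s))"
  proof (cases "A \<le> B")
    case True
    then show ?thesis
      using assms by (intro mult_nonpos_nonpos) (auto intro: power_mono)
  next
    case False
    then show ?thesis
      using assms by (intro mult_nonneg_nonneg) (auto intro: power_mono)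
  qed
  ultimately show ?thesis
    by (simp add: algebra_simps add_divide_distrib)
qed

theorem theorem1p2:
  fixes n s :: nat and a b :: "nat \<Rightarrow> real"
  assumes "n \<ge> 1"
    and "1 < inner_prod n a b"
    and "s \<ge> 1"
  shows "\<bar>iterated_integral (\<lambda>j. \<bar>a j\<bar>) (\<lambda>j. \<bar>b j\<bar>) n
            (\<lambda>x. root (4 * s) (\<Sum>j=1..n. x j ^ (4 * s))) (\<lambda>_. 0)\<bar>
         \<le> \<bar>inner_prod n a b\<bar> / (2 * pi * \<bar>ln (inner_prod n a b)\<bar>)
            * (euclid_norm n a ^ (4 * s + 1) + euclid_norm n b ^ (4 * s + 1))
            * \<bar>\<Prod>j=1..n. (\<bar>b j\<bar> - \<bar>a j\<bar>)\<bar>"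
proof -
  define X where "X = inner_prod n a b"
  define A where "A = euclid_norm n a"
  define B where "B = euclid_norm n b"
  have X: "1 < X"
    using assms(2) by (simp add: X_def)
  \<comment> \<open>This form gives access to the Cauchy-Schwarz and triangle inequalities.\<close>
  have A_L2: "A = L2_set a {1..n}" and B_L2: "B = L2_set b {1..n}"
    by (simp_all add: A_def B_def euclid_norm_def inner_prod_def L2_set_def power2_eq_square)
  have nonneg: "0 \<le> A" "0 \<le> B"
    by (simp_all add: A_L2 B_L2)
  have "X \<le> (\<Sum>j=1..n. \<bar>a j\<bar> * \<bar>b j\<bar>)"
    unfolding X_def inner_prod_def by (intro sum_mono) (simp flip: abs_mult)
  also have "\<dots> \<le> A * B"
    unfolding A_L2 B_L2 by (rule L2_set_mult_ineq)
  finally have XAB: "X \<le> A * B" .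

  have "\<bar>root (4 * s) (\<Sum>j=1..n. y j ^ (4 * s))\<bar> \<le> A + B"
    if y: "\<forall>j\<in>{1..n}. min \<bar>a j\<bar> \<bar>b j\<bar> \<le> y j \<and> y j \<le> max \<bar>a j\<bar> \<bar>b j\<bar>" for y
  proof -
    \<comment> \<open>The sum dominates the larger of the two limits, whichever it is, and suits the
      triangle inequality.\<close>
    have y': "\<bar>y j\<bar> \<le> \<bar>a j\<bar> + \<bar>b j\<bar>" if "j \<in> {1..n}" for j
      using y[rule_format, OF that] by (auto simp: min_def max_def split: if_splits)
    have "0 \<le> (\<Sum>j=1..n. y j ^ (4 * s))"
      by (intro sum_nonneg) (simp add: zero_le_even_power)
    then have "\<bar>root (4 * s) (\<Sum>j=1..n. y j ^ (4 * s))\<bar> = root (4 * s) (\<Sum>j=1..n. y j ^ (4 * s))"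
      by (simp add: real_root_ge_zero)
    also have "\<dots> \<le> L2_set (\<lambda>j. \<bar>y j\<bar>) {1..n}"
      using root_sum_power_le_sqrt_sum_squares[of "{1..n}" s y] assms(3) by (simp add: L2_set_def)
    also have "\<dots> \<le> L2_set (\<lambda>j. \<bar>a j\<bar> + \<bar>b j\<bar>) {1..n}"
      using y' by (intro L2_set_mono) auto
    also have "\<dots> \<le> L2_set (\<lambda>j. \<bar>a j\<bar>) {1..n} + L2_set (\<lambda>j. \<bar>b j\<bar>) {1..n}"
      by (rule L2_set_triangle_ineq)
    also have "\<dots> = A + B"
      by (simp add: A_L2 B_L2 L2_set_def)
    finally show ?thesis .
  qed
  then have "\<bar>iterated_integral (\<lambda>j. \<bar>a j\<bar>) (\<lambda>j. \<bar>b j\<bar>) n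
            (\<lambda>x. root (4 * s) (\<Sum>j=1..n. x j ^ (4 * s))) (\<lambda>_. 0)\<bar>
      \<le> (A + B) * \<bar>\<Prod>j=1..n. (\<bar>b j\<bar> - \<bar>a j\<bar>)\<bar>"
    by (intro abs_iterated_integral_le) auto
  also have "A + B \<le> X / (2 * pi * ln X) * (A ^ (4 * s + 1) + B ^ (4 * s + 1))"
  proof -
    \<comment> \<open>The exponent \<open>2 * s + 1\<close> is at least 3 since \<open>s\<close> is
      positive. One factor \<open>X\<close> becomes the numerator of the claimed constant; the other
      \<open>2 * s\<close> are absorbed into the powers of the norms.\<close>
    have "(2 * pi * ln X) * (A + B) \<le> X ^ (2 * s + 1) * (A + B)"
      using X assms(3) nonneg by (intro mult_right_mono two_pi_ln_le_power) auto
    also have "\<dots> = X * ((A + B) * X ^ (2 * s))"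
      by simp
    also have "\<dots> \<le> X * (A ^ (4 * s + 1) + B ^ (4 * s + 1))"
      using X nonneg XAB by (intro mult_left_mono add_mult_power_le_power_add) auto
    finally show ?thesis
      using X by (simp add: pos_le_divide_eq mult.commute)
  qed
  finally show ?thesis
    using X by (simp add: X_def A_def B_def mult_right_mono)
qed

end
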